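(* Let $(X,Y)$ be a random vector with marginal distributions $F,G$ and let $\Theta$ be a non-negative random variable with distribution $B$ such that $B(0)<1$. Suppose that $\Theta$ and $(X,Y)$ are independent, that $(X,Y)\in(\mathcal{D}\cap\mathcal{L})^{(2)}$, and that for every $c>0$ $$\mathbf{P}[\Theta>c\,(x\wedge y)]=o\big(\mathbf{P}[\Theta X>x,\ \Theta Y>y]\big),\qquad x\wedge y\to\infty.$$ Then $(\Theta X,\Theta Y)\in(\mathcal{D}\cap\mathcal{L})^{(2)}$.
   Context: $x\wedge y=\min\{x,y\}$; $f(x,y)=o(g(x,y))$ as $x\wedge y\to\infty$ means $\lim_{x\wedge y\to\infty}f(x,y)/g(x,y)=0$. For a distribution $F$, $\overline F=1-F$; $F$ and $G$ satisfy $\overline F(x)>0$, $\overline G(x)>0$ for all $x\ge0$. Joint tails in denominators are implicitly positive. $F\in\mathcal{L}$ (long-tailed) if $\lim_{x\to\infty}\overline F(x-a)/\overline F(x)=1$ for every $a>0$. $F\in\mathcal{D}$ (dominatedly varying) if $\limsup_{x\to\infty}\overline F(bx)/\overline F(x)<\infty$ for some (equivalently all) $b\in(0,1)$. For a pair $(X,Y)$ with marginal distributions $F,G$: $(X,Y)\in\mathcal{L}^{(2)}$ if $F,G\in\mathcal{L}$ and $\lim_{x\wedge y\to\infty}\mathbf{P}[X>x-a_1,Y>y-a_2]/\mathbf{P}[X>x,Y>y]=1$ for every $(a_1,a_2)\in[0,\infty)^2\setminus\{(0,0)\}$; $(X,Y)\in\mathcal{D}^{(2)}$ if $F,G\in\mathcal{D}$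 and $\limsup_{x\wedge y\to\infty}\mathbf{P}[X>b_1x,Y>b_2y]/\mathbf{P}[X>x,Y>y]<\infty$ for some (equivalently all) $(b_1,b_2)\in(0,1)^2$; $(\mathcal{D}\cap\mathcal{L})^{(2)}=\mathcal{D}^{(2)}\cap\mathcal{L}^{(2)}$. The distribution $B$ is allowed to have support bounded from above. *)

theory Defs
  imports "HOL-Probability.Probability"
begin

text \<open>The mode of convergence in which the minimum of the two coordinates tends to infinity; the
  coordinates are otherwise unrelated, so this is the product filter.\<close>

definition min_at_top :: "(real \<times> real) filter" where
  "min_at_top = filtercomap (\<lambda>(x, y). min x y) at_top"

lemma min_at_top_eq_prod: "min_at_top = at_top \<times>\<^sub>F at_top"
proof -
  have "eventually P min_at_top \<longleftrightarrow> eventually P (at_top \<times>\<^sub>F at_top)" for P :: "real \<times> real \<Rightarrow> bool"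
  proof
    assume "eventually P min_at_top"
    then obtain Q N where "\<And>z. z \<ge> N \<Longrightarrow> Q z" "\<And>x y. Q (min x y) \<Longrightarrow> P (x, y)"
      unfolding min_at_top_def eventually_filtercomap eventually_at_top_linorder by auto
    then show "eventually P (at_top \<times>\<^sub>F at_top)"
      unfolding eventually_prod_filter
      by (intro exI[of _ "\<lambda>x. x \<ge> N"] conjI) auto
  next
    assume "eventually P (at_top \<times>\<^sub>F at_top)"
    then obtain Q R where "eventually Q at_top" "eventually R at_top"
      and QR: "\<And>x y. Q x \<Longrightarrow> R y \<Longrightarrow> P (x, y)"
      unfolding eventually_prod_filter by auto
    then obtain M N where "\<And>x. x \<ge> M \<Longrightarrow> Q x" "\<And>y. y \<ge> N \<Longrightarrow> R y"
      unfolding eventually_at_top_linorder by blast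
    with QR show "eventually P min_at_top"
      unfolding min_at_top_def eventually_filtercomap
      by (intro exI[of _ "\<lambda>z. z \<ge> max M N"] conjI eventually_ge_at_top) auto
  qed
  then show ?thesis by (simp add: filter_eq_iff)
qed

text \<open>Independence of two random variables whose target types may differ: the library's
  \<open>indep_var\<close> requires a common type, so its characterization \<open>indep_var_eq\<close> via the generated
  sigma-algebras is taken over.\<close>

definition independent_rvs ::
    "'a measure \<Rightarrow> 'b measure \<Rightarrow> ('a \<Rightarrow> 'b) \<Rightarrow> 'c measure \<Rightarrow> ('a \<Rightarrow> 'c) \<Rightarrow> bool" where
  "independent_rvs M S U T V \<longleftrightarrow>
     U \<in> measurable M S \<and> V \<in> measurable M T \<and>
     prob_space.indep_set M
       (sigma_sets (space M) {U -` A \<inter> space M | A. A \<in> sets S})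
       (sigma_sets (space M) {V -` A \<inter> space M | A. A \<in> sets T})"

definition tail :: "real measure \<Rightarrow> real \<Rightarrow> real" where
  "tail F x = 1 - cdf F x"

definition joint_tail :: "'a measure \<Rightarrow> ('a \<Rightarrow> real) \<Rightarrow> ('a \<Rightarrow> real) \<Rightarrow> real \<Rightarrow> real \<Rightarrow> real" where
  "joint_tail M X Y x y = \<P>(\<omega> in M. X \<omega> > x \<and> Y \<omega> > y)"

text \<open>Tails that occur as denominators are required to be positive in each of the following classes.
  This matters for the dominatedly varying ones: since \<open>x / 0 = 0\<close>, the bound on the limit superior
  would otherwise hold for every distribution whose support is bounded from above.\<close>

definition long_tailed :: "real measure \<Rightarrow> bool" where
  "long_tailed F \<longleftrightarrow>
     (\<forall>x\<ge>0. tail F x > 0) \<and>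
     (\<forall>a>0. ((\<lambda>x. tail F (x - a) / tail F x) \<longlongrightarrow> 1) at_top)"

definition dominatedly_varying :: "real measure \<Rightarrow> bool" where
  "dominatedly_varying F \<longleftrightarrow>
     (\<forall>x\<ge>0. tail F x > 0) \<and>
     (\<exists>b\<in>{0<..<1}. Limsup at_top (\<lambda>x. ereal (tail F (b * x) / tail F x)) < \<infinity>)"

definition long_tailed2 :: "'a measure \<Rightarrow> ('a \<Rightarrow> real) \<Rightarrow> ('a \<Rightarrow> real) \<Rightarrow> bool" where
  "long_tailed2 M X Y \<longleftrightarrow>
     long_tailed (distr M borel X) \<and> long_tailed (distr M borel Y) \<and>
     (\<forall>x\<ge>0. \<forall>y\<ge>0. joint_tail M X Y x y > 0) \<and>
     (\<forall>(a1, a2) \<in> ({0..} \<times> {0..}) - {(0, 0)}.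
        ((\<lambda>(x, y). joint_tail M X Y (x - a1) (y - a2) / joint_tail M X Y x y) \<longlongrightarrow> 1) min_at_top)"

definition dominatedly_varying2 :: "'a measure \<Rightarrow> ('a \<Rightarrow> real) \<Rightarrow> ('a \<Rightarrow> real) \<Rightarrow> bool" where
  "dominatedly_varying2 M X Y \<longleftrightarrow>
     dominatedly_varying (distr M borel X) \<and> dominatedly_varying (distr M borel Y) \<and>
     (\<forall>x\<ge>0. \<forall>y\<ge>0. joint_tail M X Y x y > 0) \<and>
     (\<exists>(b1, b2) \<in> {0<..<1} \<times> {0<..<1}.
        Limsup min_at_top
          (\<lambda>(x, y). ereal (joint_tail M X Y (b1 * x) (b2 * y) / joint_tail M X Y x y)) < \<infinity>)"

definition dominatedly_varying_long_tailed2 ::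
    "'a measure \<Rightarrow> ('a \<Rightarrow> real) \<Rightarrow> ('a \<Rightarrow> real) \<Rightarrow> bool" where
  "dominatedly_varying_long_tailed2 M X Y \<longleftrightarrow> dominatedly_varying2 M X Y \<and> long_tailed2 M X Y"

end

theory Submission
  imports Defs
begin

text \<open>
  Write \<open>H\<close> for the joint tail of \<open>(X, Y)\<close> and \<open>H*\<close> for that of \<open>(\<Theta>X, \<Theta>Y)\<close>. By independence,
  for \<open>x, y \<ge> 0\<close>,
  \<open>H* (x, y)\<close> is the integral of \<open>H (x / \<theta>, y / \<theta>)\<close> against the law of \<open>\<Theta>\<close> on \<open>{0<..}\<close>, so an
  asymptotic inequality for \<open>H\<close>, valid once both arguments exceed \<open>N\<close>, can be integrated over
  all \<open>\<theta> \<le> min x y / N\<close>. The remaining event \<open>\<Theta> > min x y / N\<close> is negligible against \<open>H*\<close>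
  by the assumption on the tail of \<open>\<Theta>\<close>. Applied to \<open>H (b1 x, b2 y) \<le> C H (x, y)\<close>, this gives
  dominated variation of \<open>H*\<close>.

  For long-tailedness, a shift of \<open>x\<close> by \<open>a\<close> becomes a shift of \<open>x / \<theta>\<close> by \<open>a / \<theta>\<close>, which is
  bounded only while \<open>\<theta>\<close> stays above some \<open>\<delta> > 0\<close>; there long-tailedness of \<open>H\<close> applies. For
  \<open>\<theta> \<le> \<delta>\<close> the shift is replaced by the coarser bound \<open>x - a \<ge> b x\<close>, and dominated variation costs
  a constant factor \<open>C\<close>. This is affordable because monotonicity of \<open>H\<close> shows that the scales
  \<open>\<theta> \<le> \<delta>\<close> contribute at most the fraction \<open>P(0 < \<Theta> \<le> \<delta>) / P(\<Theta> > \<delta>)\<close> of \<open>H*\<close>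
  (\<open>small_scale_part_le\<close>), and this fraction vanishes with \<open>\<delta>\<close> because \<open>\<Theta>\<close> is not almost surely
  zero.

  The marginals need the same argument in one dimension. It is obtained by taking \<open>Y = X\<close>: the
  joint tail of \<open>(X, X)\<close> is the tail of \<open>X\<close> at \<open>max x y\<close>, which inherits the two-dimensional
  bounds from the one-dimensional ones. The assumption on the tail of \<open>\<Theta>\<close>, however, survives only
  on the diagonal \<open>x = y\<close>, where \<open>min x y\<close> and \<open>max x y\<close> agree. The two central lemmas
  (\<open>scaled_tail_dominated\<close>, \<open>scaled_tail_long_tailed\<close>) are therefore stated for a limit along an
  arbitrary filter finer than \<open>min_at_top\<close>.
\<close>

section \<open>Independence and the law of the scaled pair\<close>

lemma (in prob_space) independent_rvs_compose:
  assumes indep: "independent_rvs M S U T V" and f: "f \<in> measurable T T'"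
  shows "independent_rvs M S U T' (\<lambda>\<omega>. f (V \<omega>))"
proof -
  have U: "U \<in> measurable M S" and V: "V \<in> measurable M T"
    using indep by (auto simp: independent_rvs_def)
  have fV: "(\<lambda>\<omega>. f (V \<omega>)) \<in> measurable M T'"
    using measurable_compose[OF V f] .
  have sub: "{(\<lambda>\<omega>. f (V \<omega>)) -` A \<inter> space M |A. A \<in> sets T'} \<subseteq> {V -` A \<inter> space M |A. A \<in> sets T}"
  proof safe
    fix A assume A: "A \<in> sets T'"
    have "(\<lambda>\<omega>. f (V \<omega>)) -` A \<inter> space M = V -` (f -` A \<inter> space T) \<inter> space M"
      using measurable_space[OF V] by auto
    with measurable_sets[OF f A]
    show "\<exists>B. (\<lambda>\<omega>. f (V \<omega>)) -` A \<inter> space M = V -` B \<inter> space M \<and> B \<in> sets T" by blast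
  qed
  show ?thesis
    using indep U fV sigma_sets_mono'[OF sub]
    unfolding independent_rvs_def indep_sets2_eq by blast
qed

locale scaled_pair = prob_space M
  for M :: "'a measure" and X Y \<Theta> :: "'a \<Rightarrow> real" +
  assumes X [measurable]: "X \<in> borel_measurable M"
    and Y [measurable]: "Y \<in> borel_measurable M"
    and scale [measurable]: "\<Theta> \<in> borel_measurable M"
    and scale_nonneg: "AE \<omega> in M. \<Theta> \<omega> \<ge> 0"
    and scale_indep: "independent_rvs M borel \<Theta> borel (\<lambda>\<omega>. (X \<omega>, Y \<omega>))"
begin

abbreviation "scaled_tail \<equiv> joint_tail M (\<lambda>\<omega>. \<Theta> \<omega> * X \<omega>) (\<lambda>\<omega>. \<Theta> \<omega> * Y \<omega>)"

lemma prob_scale_pair: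
  assumes A: "A \<in> sets borel" and B: "B \<in> sets borel"
  shows "\<P>(\<omega> in M. \<Theta> \<omega> \<in> A \<and> (X \<omega>, Y \<omega>) \<in> B) = \<P>(\<omega> in M. \<Theta> \<omega> \<in> A) * \<P>(\<omega> in M. (X \<omega>, Y \<omega>) \<in> B)"
proof -
  have "prob ((\<Theta> -` A \<inter> space M) \<inter> ((\<lambda>\<omega>. (X \<omega>, Y \<omega>)) -` B \<inter> space M)) =
      prob (\<Theta> -` A \<inter> space M) * prob ((\<lambda>\<omega>. (X \<omega>, Y \<omega>)) -` B \<inter> space M)"
    using scale_indep A B unfolding independent_rvs_def indep_sets2_eq by blast
  moreover have "(\<Theta> -` A \<inter> space M) \<inter> ((\<lambda>\<omega>. (X \<omega>, Y \<omega>)) -` B \<inter> space M)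
      = {\<omega> \<in> space M. \<Theta> \<omega> \<in> A \<and> (X \<omega>, Y \<omega>) \<in> B}"
    by auto
  ultimately show ?thesis
    by (simp add: vimage_def Int_def conj_commute)
qed

lemma distr_scale_pair:
  "distr M borel \<Theta> \<Otimes>\<^sub>M distr M borel (\<lambda>\<omega>. (X \<omega>, Y \<omega>))
    = distr M (borel \<Otimes>\<^sub>M borel) (\<lambda>\<omega>. (\<Theta> \<omega>, X \<omega>, Y \<omega>))"
proof (rule pair_measure_eqI)
  interpret T: prob_space "distr M borel \<Theta>" by (rule prob_space_distr) simp
  show "sigma_finite_measure (distr M borel \<Theta>)" ..
  interpret XY: prob_space "distr M borel (\<lambda>\<omega>. (X \<omega>, Y \<omega>))" by (rule prob_space_distr) simp
  show "sigma_finite_measure (distr M borel (\<lambda>\<omega>. (X \<omega>, Y \<omega>)))" ..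
  show "sets (distr M borel \<Theta> \<Otimes>\<^sub>M distr M borel (\<lambda>\<omega>. (X \<omega>, Y \<omega>)))
      = sets (distr M (borel \<Otimes>\<^sub>M borel) (\<lambda>\<omega>. (\<Theta> \<omega>, X \<omega>, Y \<omega>)))"
    by (simp cong: sets_pair_measure_cong)
  fix A B assume "A \<in> sets (distr M borel \<Theta>)" "B \<in> sets (distr M borel (\<lambda>\<omega>. (X \<omega>, Y \<omega>)))"
  then have [measurable]: "A \<in> sets borel" "B \<in> sets borel" by auto
  have "emeasure M (\<Theta> -` A \<inter> space M) * emeasure M ((\<lambda>\<omega>. (X \<omega>, Y \<omega>)) -` B \<inter> space M)
      = ennreal (\<P>(\<omega> in M. \<Theta> \<omega> \<in> A \<and> (X \<omega>, Y \<omega>) \<in> B))"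
    by (simp add: prob_scale_pair emeasure_eq_measure ennreal_mult vimage_def Int_def conj_commute)
  also have "\<dots> = emeasure M ((\<lambda>\<omega>. (\<Theta> \<omega>, X \<omega>, Y \<omega>)) -` (A \<times> B) \<inter> space M)"
    by (simp add: emeasure_eq_measure vimage_def Int_def conj_commute)
  finally show "emeasure (distr M borel \<Theta>) A * emeasure (distr M borel (\<lambda>\<omega>. (X \<omega>, Y \<omega>))) B
      = emeasure (distr M (borel \<Otimes>\<^sub>M borel) (\<lambda>\<omega>. (\<Theta> \<omega>, X \<omega>, Y \<omega>))) (A \<times> B)"
    by (simp add: emeasure_distr)
qed

text \<open>Conditioning on the scale. Keeping the restriction to a set \<open>S\<close> of scales allows the different
  ranges of \<open>\<Theta>\<close> to be estimated by different properties of the pair.\<close>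

lemma scaled_tail_on_eq_nn_integral:
  assumes [measurable]: "S \<in> sets borel"
  shows "ennreal (\<P>(\<omega> in M. \<Theta> \<omega> \<in> S \<and> \<Theta> \<omega> * X \<omega> > x \<and> \<Theta> \<omega> * Y \<omega> > y))
    = (\<integral>\<^sup>+\<theta>. indicator S \<theta> * ennreal (joint_tail M (\<lambda>\<omega>. \<theta> * X \<omega>) (\<lambda>\<omega>. \<theta> * Y \<omega>) x y) \<partial>distr M borel \<Theta>)"
proof -
  interpret XY: prob_space "distr M borel (\<lambda>\<omega>. (X \<omega>, Y \<omega>))" by (rule prob_space_distr) simp
  define E where "E = {p :: real \<times> real \<times> real. fst p \<in> S \<and> fst p * fst (snd p) > x \<and> fst p * snd (snd p) > y}"
  have E_borel [measurable]: "E \<in> sets (borel \<Otimes>\<^sub>M borel)"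
  proof -
    have "{p \<in> space (borel \<Otimes>\<^sub>M (borel \<Otimes>\<^sub>M borel)).
        fst p \<in> S \<and> fst p * fst (snd p) > x \<and> fst p * snd (snd p) > y}
      \<in> sets (borel \<Otimes>\<^sub>M (borel \<Otimes>\<^sub>M borel))"
      by measurable
    then show ?thesis unfolding borel_prod E_def by simp
  qed
  have measurable_scale_pair: "(\<lambda>\<omega>. (\<Theta> \<omega>, X \<omega>, Y \<omega>)) \<in> measurable M (borel \<Otimes>\<^sub>M borel)"
    by measurable
  have "ennreal (\<P>(\<omega> in M. \<Theta> \<omega> \<in> S \<and> \<Theta> \<omega> * X \<omega> > x \<and> \<Theta> \<omega> * Y \<omega> > y))
      = emeasure (distr M (borel \<Otimes>\<^sub>M borel) (\<lambda>\<omega>. (\<Theta> \<omega>, X \<omega>, Y \<omega>))) E"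
    unfolding emeasure_distr[OF measurable_scale_pair E_borel] emeasure_eq_measure
    by (simp add: vimage_def Int_def conj_commute E_def)
  also have "\<dots> = (\<integral>\<^sup>+\<theta>. emeasure (distr M borel (\<lambda>\<omega>. (X \<omega>, Y \<omega>))) (Pair \<theta> -` E) \<partial>distr M borel \<Theta>)"
    unfolding distr_scale_pair[symmetric]
    by (rule XY.emeasure_pair_measure_alt) (use E_borel in \<open>simp cong: sets_pair_measure_cong\<close>)
  also have "\<dots> = (\<integral>\<^sup>+\<theta>. indicator S \<theta> * ennreal (joint_tail M (\<lambda>\<omega>. \<theta> * X \<omega>) (\<lambda>\<omega>. \<theta> * Y \<omega>) x y) \<partial>distr M borel \<Theta>)"
  proof (rule nn_integral_cong)
    fix \<theta> :: real
    have [measurable]: "Pair \<theta> -` E \<in> sets borel"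
      using sets_Pair1[OF E_borel] by simp
    have "(\<lambda>\<omega>. (X \<omega>, Y \<omega>)) -` (Pair \<theta> -` E) \<inter> space M
        = (if \<theta> \<in> S then {\<omega> \<in> space M. \<theta> * X \<omega> > x \<and> \<theta> * Y \<omega> > y} else {})"
      by (auto simp: E_def)
    then show "emeasure (distr M borel (\<lambda>\<omega>. (X \<omega>, Y \<omega>))) (Pair \<theta> -` E)
        = indicator S \<theta> * ennreal (joint_tail M (\<lambda>\<omega>. \<theta> * X \<omega>) (\<lambda>\<omega>. \<theta> * Y \<omega>) x y)"
      by (simp add: emeasure_distr emeasure_eq_measure joint_tail_def)
  qed
  finally show ?thesis .
qed

lemma scaled_tail_on_le:
  assumes [measurable]: "S \<in> sets borel" and C: "0 \<le> C"
    and le: "\<And>\<theta>. \<theta> \<in> S \<Longrightarrow> joint_tail M (\<lambda>\<omega>. \<theta> * X \<omega>) (\<lambda>\<omega>. \<theta> * Y \<omega>) u v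
      \<le> C * joint_tail M (\<lambda>\<omega>. \<theta> * X \<omega>) (\<lambda>\<omega>. \<theta> * Y \<omega>) x y"
  shows "\<P>(\<omega> in M. \<Theta> \<omega> \<in> S \<and> \<Theta> \<omega> * X \<omega> > u \<and> \<Theta> \<omega> * Y \<omega> > v)
    \<le> C * \<P>(\<omega> in M. \<Theta> \<omega> \<in> S \<and> \<Theta> \<omega> * X \<omega> > x \<and> \<Theta> \<omega> * Y \<omega> > y)"
proof -
  let ?h = "\<lambda>x y \<theta>. joint_tail M (\<lambda>\<omega>. \<theta> * X \<omega>) (\<lambda>\<omega>. \<theta> * Y \<omega>) x y"
  have meas: "(\<lambda>\<theta>. ennreal (?h x y \<theta>)) \<in> borel_measurable borel"
  proof -
    have "(\<lambda>\<theta>. emeasure M {\<omega> \<in> space M. \<theta> * X \<omega> > x \<and> \<theta> * Y \<omega> > y}) \<in> borel_measurable borel"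
      by measurable
    then show ?thesis by (simp add: joint_tail_def emeasure_eq_measure)
  qed
  have "ennreal (\<P>(\<omega> in M. \<Theta> \<omega> \<in> S \<and> \<Theta> \<omega> * X \<omega> > u \<and> \<Theta> \<omega> * Y \<omega> > v))
      \<le> (\<integral>\<^sup>+\<theta>. ennreal C * (indicator S \<theta> * ennreal (?h x y \<theta>)) \<partial>distr M borel \<Theta>)"
    unfolding scaled_tail_on_eq_nn_integral[OF assms(1)]
  proof (rule nn_integral_mono)
    fix \<theta>
    show "indicator S \<theta> * ennreal (?h u v \<theta>) \<le> ennreal C * (indicator S \<theta> * ennreal (?h x y \<theta>))"
      using le[of \<theta>] C
      by (cases "\<theta> \<in> S") (auto simp: ennreal_mult[symmetric] joint_tail_def intro!: ennreal_leI)
  qed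
  also have "\<dots> = ennreal C * (\<integral>\<^sup>+\<theta>. indicator S \<theta> * ennreal (?h x y \<theta>) \<partial>distr M borel \<Theta>)"
    using meas by (intro nn_integral_cmult) simp
  also have "\<dots> = ennreal (C * \<P>(\<omega> in M. \<Theta> \<omega> \<in> S \<and> \<Theta> \<omega> * X \<omega> > x \<and> \<Theta> \<omega> * Y \<omega> > y))"
    unfolding scaled_tail_on_eq_nn_integral[OF assms(1), symmetric] using C by (simp add: ennreal_mult)
  finally show ?thesis
    using C by (subst (asm) ennreal_le_iff) simp_all
qed

section \<open>Estimates by size of the scale\<close>

text \<open>The scale zero is missing on the right: it makes both products zero, so that neither exceeds a
  non-negative threshold.\<close>

lemma scaled_tail_split:
  assumes "0 \<le> u" "0 \<le> v"
  shows "scaled_tail u v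
    \<le> \<P>(\<omega> in M. \<Theta> \<omega> \<in> {0<..\<delta>} \<and> \<Theta> \<omega> * X \<omega> > u \<and> \<Theta> \<omega> * Y \<omega> > v)
      + \<P>(\<omega> in M. \<Theta> \<omega> \<in> {\<delta><..t} \<and> \<Theta> \<omega> * X \<omega> > u \<and> \<Theta> \<omega> * Y \<omega> > v)
      + \<P>(\<omega> in M. \<Theta> \<omega> > t)" (is "_ \<le> prob ?A + prob ?B + prob ?C")
proof -
  have "scaled_tail u v \<le> prob ((?A \<union> ?B) \<union> ?C)"
    unfolding joint_tail_def
  proof (rule finite_measure_mono_AE)
    show "AE \<omega> in M. \<omega> \<in> {\<omega> \<in> space M. \<Theta> \<omega> * X \<omega> > u \<and> \<Theta> \<omega> * Y \<omega> > v} \<longrightarrow> \<omega> \<in> (?A \<union> ?B) \<union> ?C"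
      using scale_nonneg
    proof eventually_elim
      case (elim \<omega>)
      then show ?case using assms by (cases "\<Theta> \<omega> = 0") auto
    qed
  qed measurable
  also have "\<dots> \<le> prob (?A \<union> ?B) + prob ?C"
    by (rule measure_Un_le) measurable
  also have "prob (?A \<union> ?B) \<le> prob ?A + prob ?B"
    by (rule measure_Un_le) measurable
  finally show ?thesis by simp
qed

lemma joint_tail_mult:
  assumes "\<theta> > 0"
  shows "joint_tail M (\<lambda>\<omega>. \<theta> * X \<omega>) (\<lambda>\<omega>. \<theta> * Y \<omega>) x y = joint_tail M X Y (x / \<theta>) (y / \<theta>)"
  using assms by (simp add: joint_tail_def field_simps)

lemma joint_tail_mono:
  assumes "x' \<le> x" "y' \<le> y"
  shows "joint_tail M X Y x y \<le> joint_tail M X Y x' y'"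
  unfolding joint_tail_def using assms by (intro finite_measure_mono) auto

lemma scaled_tail_mono:
  assumes "x' \<le> x" "y' \<le> y"
  shows "scaled_tail x y \<le> scaled_tail x' y'"
  unfolding joint_tail_def using assms by (intro finite_measure_mono) auto

lemma prob_scale_tail:
  assumes [measurable]: "S \<in> sets borel"
  shows "\<P>(\<omega> in M. \<Theta> \<omega> \<in> S \<and> X \<omega> > x \<and> Y \<omega> > y) = \<P>(\<omega> in M. \<Theta> \<omega> \<in> S) * joint_tail M X Y x y"
  using prob_scale_pair[of S "{x<..} \<times> {y<..}"]
  by (simp add: joint_tail_def borel_prod[symmetric])

lemma scaled_tail_ge:
  assumes "\<delta> > 0" "x \<ge> 0" "y \<ge> 0"
  shows "\<P>(\<omega> in M. \<Theta> \<omega> > \<delta>) * joint_tail M X Y (x / \<delta>) (y / \<delta>) \<le> scaled_tail x y"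
proof -
  have gt: "\<theta> * z > w" if "\<theta> > \<delta>" "z > w / \<delta>" "w \<ge> 0" for \<theta> z w
  proof -
    have "w < \<delta> * z" using that assms(1) by (simp add: field_simps)
    also have "\<delta> * z \<le> \<theta> * z"
      using that assms(1) by (intro mult_right_mono) (auto intro: order.trans[of 0 "w / \<delta>"])
    finally show ?thesis .
  qed
  have "\<P>(\<omega> in M. \<Theta> \<omega> \<in> {\<delta><..} \<and> X \<omega> > x / \<delta> \<and> Y \<omega> > y / \<delta>) \<le> scaled_tail x y"
    unfolding joint_tail_def using assms gt by (intro finite_measure_mono) auto
  then show ?thesis using prob_scale_tail[of "{\<delta><..}"] by simp
qed

text \<open>Both sides are compared with the joint tail at \<open>(x / \<delta>, y / \<delta>)\<close>: a scale below \<open>\<delta>\<close> requires the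
  pair to exceed this point, whereas for a scale above \<open>\<delta>\<close> exceeding it is enough.\<close>

lemma small_scale_part_le:
  assumes "\<delta> > 0" "x \<ge> 0" "y \<ge> 0"
  shows "\<P>(\<omega> in M. \<Theta> \<omega> \<in> {0<..\<delta>} \<and> \<Theta> \<omega> * X \<omega> > x \<and> \<Theta> \<omega> * Y \<omega> > y) * \<P>(\<omega> in M. \<Theta> \<omega> > \<delta>)
    \<le> \<P>(\<omega> in M. \<Theta> \<omega> \<in> {0<..\<delta>}) * scaled_tail x y"
proof -
  have gt: "z > w / \<delta>" if "\<theta> * z > w" "\<theta> \<in> {0<..\<delta>}" "w \<ge> 0" for \<theta> z w
  proof -
    have "z > 0" using that by (smt (verit) greaterThanAtMost_iff zero_less_mult_iff)
    then have "\<theta> * z \<le> \<delta> * z" using that by (intro mult_right_mono) auto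
    then have "w < \<delta> * z" using that by simp
    then show ?thesis using assms(1) by (simp add: field_simps)
  qed
  have "\<P>(\<omega> in M. \<Theta> \<omega> \<in> {0<..\<delta>} \<and> \<Theta> \<omega> * X \<omega> > x \<and> \<Theta> \<omega> * Y \<omega> > y)
      \<le> \<P>(\<omega> in M. \<Theta> \<omega> \<in> {0<..\<delta>} \<and> X \<omega> > x / \<delta> \<and> Y \<omega> > y / \<delta>)"
    using assms gt by (intro finite_measure_mono) auto
  also have "\<dots> = \<P>(\<omega> in M. \<Theta> \<omega> \<in> {0<..\<delta>}) * joint_tail M X Y (x / \<delta>) (y / \<delta>)"
    by (rule prob_scale_tail) simp
  finally have "\<P>(\<omega> in M. \<Theta> \<omega> \<in> {0<..\<delta>} \<and> \<Theta> \<omega> * X \<omega> > x \<and> \<Theta> \<omega> * Y \<omega> > y) * \<P>(\<omega> in M. \<Theta> \<omega> > \<delta>)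
      \<le> \<P>(\<omega> in M. \<Theta> \<omega> \<in> {0<..\<delta>}) * joint_tail M X Y (x / \<delta>) (y / \<delta>) * \<P>(\<omega> in M. \<Theta> \<omega> > \<delta>)"
    by (rule mult_right_mono) simp
  also have "\<dots> = \<P>(\<omega> in M. \<Theta> \<omega> \<in> {0<..\<delta>}) * (\<P>(\<omega> in M. \<Theta> \<omega> > \<delta>) * joint_tail M X Y (x / \<delta>) (y / \<delta>))"
    by simp
  also have "\<dots> \<le> \<P>(\<omega> in M. \<Theta> \<omega> \<in> {0<..\<delta>}) * scaled_tail x y"
    by (intro mult_left_mono scaled_tail_ge assms) simp
  finally show ?thesis .
qed

lemma dominated_part_le:
  assumes [measurable]: "S \<in> sets borel"
    and S: "S \<subseteq> {0<..min x y / N}" and N: "0 < N" and C: "0 \<le> C"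
    and dom: "\<And>x y. x \<ge> N \<Longrightarrow> y \<ge> N \<Longrightarrow> joint_tail M X Y (b1 * x) (b2 * y) \<le> C * joint_tail M X Y x y"
  shows "\<P>(\<omega> in M. \<Theta> \<omega> \<in> S \<and> \<Theta> \<omega> * X \<omega> > b1 * x \<and> \<Theta> \<omega> * Y \<omega> > b2 * y)
    \<le> C * \<P>(\<omega> in M. \<Theta> \<omega> \<in> S \<and> \<Theta> \<omega> * X \<omega> > x \<and> \<Theta> \<omega> * Y \<omega> > y)"
proof (rule scaled_tail_on_le)
  fix \<theta> assume "\<theta> \<in> S"
  with S have "\<theta> > 0" "\<theta> \<le> min x y / N" by auto
  moreover from this N have "x / \<theta> \<ge> N" "y / \<theta> \<ge> N" by (auto simp: field_simps)
  ultimately show "joint_tail M (\<lambda>\<omega>. \<theta> * X \<omega>) (\<lambda>\<omega>. \<theta> * Y \<omega>) (b1 * x) (b2 * y)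
      \<le> C * joint_tail M (\<lambda>\<omega>. \<theta> * X \<omega>) (\<lambda>\<omega>. \<theta> * Y \<omega>) x y"
    using dom[of "x / \<theta>" "y / \<theta>"] by (simp add: joint_tail_mult)
qed (use C in auto)

text \<open>The restriction \<open>\<theta> > \<delta>\<close> makes the rescaled shifts \<open>a1 / \<theta>\<close>, \<open>a2 / \<theta>\<close> bounded, so that a single
  threshold \<open>N\<close> serves all scales.\<close>

lemma shifted_part_le:
  assumes N: "0 < N" and K: "0 \<le> K" and \<delta>: "0 < \<delta>" and a: "0 \<le> a1" "0 \<le> a2"
    and long: "\<And>x y. x \<ge> N \<Longrightarrow> y \<ge> N \<Longrightarrow>
      joint_tail M X Y (x - a1 / \<delta>) (y - a2 / \<delta>) \<le> K * joint_tail M X Y x y"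
  shows "\<P>(\<omega> in M. \<Theta> \<omega> \<in> {\<delta><..min x y / N} \<and> \<Theta> \<omega> * X \<omega> > x - a1 \<and> \<Theta> \<omega> * Y \<omega> > y - a2)
    \<le> K * \<P>(\<omega> in M. \<Theta> \<omega> \<in> {\<delta><..min x y / N} \<and> \<Theta> \<omega> * X \<omega> > x \<and> \<Theta> \<omega> * Y \<omega> > y)"
proof (rule scaled_tail_on_le)
  fix \<theta> assume "\<theta> \<in> {\<delta><..min x y / N}"
  then have \<theta>: "\<theta> > 0" "\<delta> \<le> \<theta>" "\<theta> \<le> min x y / N" using \<delta> by auto
  moreover from this N have "x / \<theta> \<ge> N" "y / \<theta> \<ge> N" by (auto simp: field_simps)
  moreover have "a1 / \<theta> \<le> a1 / \<delta>" "a2 / \<theta> \<le> a2 / \<delta>"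
    using \<theta> \<delta> a by (auto intro!: divide_left_mono)
  ultimately show "joint_tail M (\<lambda>\<omega>. \<theta> * X \<omega>) (\<lambda>\<omega>. \<theta> * Y \<omega>) (x - a1) (y - a2)
      \<le> K * joint_tail M (\<lambda>\<omega>. \<theta> * X \<omega>) (\<lambda>\<omega>. \<theta> * Y \<omega>) x y"
    using long[of "x / \<theta>" "y / \<theta>"]
      joint_tail_mono[of "x / \<theta> - a1 / \<delta>" "(x - a1) / \<theta>" "y / \<theta> - a2 / \<delta>" "(y - a2) / \<theta>"]
    by (simp add: joint_tail_mult diff_divide_distrib)
qed (use K in auto)

end

section \<open>Asymptotics of the joint tail of the scaled pair\<close>

text \<open>A positive threshold is asked for because it is used as a divisor.\<close>

lemma eventually_min_at_top:
  "eventually (\<lambda>(x, y). P x y) min_at_top \<longleftrightarrow> (\<exists>N>0. \<forall>x\<ge>N. \<forall>y\<ge>N. P x y)"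
proof
  assume "eventually (\<lambda>(x, y). P x y) min_at_top"
  then obtain Q N where "\<And>z. z \<ge> N \<Longrightarrow> Q z" "\<And>x y. Q (min x y) \<Longrightarrow> P x y"
    unfolding min_at_top_def eventually_filtercomap eventually_at_top_linorder by auto
  then show "\<exists>N>0. \<forall>x\<ge>N. \<forall>y\<ge>N. P x y"
    by (intro exI[of _ "max N 1"]) auto
next
  assume "\<exists>N>0. \<forall>x\<ge>N. \<forall>y\<ge>N. P x y"
  then obtain N where "\<forall>x\<ge>N. \<forall>y\<ge>N. P x y" by blast
  then show "eventually (\<lambda>(x, y). P x y) min_at_top"
    unfolding min_at_top_def eventually_filtercomap
    by (intro exI[of _ "\<lambda>z. z \<ge> N"] conjI eventually_ge_at_top) auto
qed

locale nondegenerate_scaled_pair = scaled_pair +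
  assumes scale_nonzero: "cdf (distr M borel \<Theta>) 0 < 1"
    and joint_tail_pos: "\<And>x y. 0 \<le> x \<Longrightarrow> 0 \<le> y \<Longrightarrow> 0 < joint_tail M X Y x y"
begin

lemma prob_scale_gt: "\<P>(\<omega> in M. \<Theta> \<omega> > t) = 1 - cdf (distr M borel \<Theta>) t"
proof -
  have "\<P>(\<omega> in M. \<Theta> \<omega> > t) = \<P>(\<omega> in M. \<not> \<Theta> \<omega> \<le> t)" by (simp add: not_le)
  also have "\<dots> = 1 - \<P>(\<omega> in M. \<Theta> \<omega> \<le> t)" by (rule prob_neg) measurable
  finally show ?thesis
    by (simp add: cdf_def measure_distr vimage_def Int_def conj_commute)
qed

text \<open>Right continuity of the distribution function of \<open>\<Theta>\<close> at zero, where its value is below one.\<close>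

lemma small_scale_negligible:
  "((\<lambda>\<delta>. \<P>(\<omega> in M. \<Theta> \<omega> \<in> {0<..\<delta>}) / \<P>(\<omega> in M. \<Theta> \<omega> > \<delta>)) \<longlongrightarrow> 0) (at_right 0)"
  and eventually_prob_scale_gt_pos: "\<forall>\<^sub>F \<delta> in at_right 0. \<P>(\<omega> in M. \<Theta> \<omega> > \<delta>) > 0"
proof -
  let ?B = "cdf (distr M borel \<Theta>)"
  interpret T: real_distribution "distr M borel \<Theta>" by (rule real_distribution_distr) simp
  have cont: "(?B \<longlongrightarrow> ?B 0) (at_right 0)"
    using T.cdf_is_right_cont[of 0] by (simp add: continuous_within)
  have "((\<lambda>\<delta>. (?B \<delta> - ?B 0) / (1 - ?B \<delta>)) \<longlongrightarrow> (?B 0 - ?B 0) / (1 - ?B 0)) (at_right 0)"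
    using cont scale_nonzero by (intro tendsto_intros) auto
  moreover have "\<forall>\<^sub>F \<delta> in at_right 0. (?B \<delta> - ?B 0) / (1 - ?B \<delta>)
      = \<P>(\<omega> in M. \<Theta> \<omega> \<in> {0<..\<delta>}) / \<P>(\<omega> in M. \<Theta> \<omega> > \<delta>)"
    using eventually_at_right_less[of "0::real"]
  proof eventually_elim
    case (elim \<delta>)
    then have "?B \<delta> - ?B 0 = \<P>(\<omega> in M. \<Theta> \<omega> \<in> {0<..\<delta>})"
      by (simp add: T.cdf_diff_eq measure_distr vimage_def Int_def conj_commute)
    then show ?case by (simp add: prob_scale_gt)
  qed
  ultimately show "((\<lambda>\<delta>. \<P>(\<omega> in M. \<Theta> \<omega> \<in> {0<..\<delta>}) / \<P>(\<omega> in M. \<Theta> \<omega> > \<delta>)) \<longlongrightarrow> 0) (at_right 0)"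
    by (rule Lim_transform_eventually[THEN tendsto_eq_rhs]) simp
  show "\<forall>\<^sub>F \<delta> in at_right 0. \<P>(\<omega> in M. \<Theta> \<omega> > \<delta>) > 0"
    using order_tendstoD(2)[OF cont scale_nonzero] by (simp add: prob_scale_gt)
qed

lemma scaled_tail_pos:
  assumes "0 \<le> x" "0 \<le> y"
  shows "0 < scaled_tail x y"
proof -
  have "\<forall>\<^sub>F \<delta> in at_right 0. 0 < \<delta> \<and> \<P>(\<omega> in M. \<Theta> \<omega> > \<delta>) > 0"
    using eventually_prob_scale_gt_pos eventually_at_right_less[of "0::real"] by eventually_elim simp
  then obtain \<delta> where \<delta>: "0 < \<delta>" "\<P>(\<omega> in M. \<Theta> \<omega> > \<delta>) > 0"
    using eventually_happens trivial_limit_at_right_real by blast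
  then have "0 < \<P>(\<omega> in M. \<Theta> \<omega> > \<delta>) * joint_tail M X Y (x / \<delta>) (y / \<delta>)"
    using assms by (intro mult_pos_pos joint_tail_pos) auto
  also have "\<dots> \<le> scaled_tail x y" using \<delta> assms by (intro scaled_tail_ge)
  finally show ?thesis .
qed

text \<open>The bound on \<open>H\<close> is required on all of \<open>min_at_top\<close>, the condition on large scales only along \<open>F\<close>.
  The bound must hold at every sufficiently large point because it is applied at the rescaled
  points \<open>(x / \<theta>, y / \<theta>)\<close>.\<close>

context
  fixes F :: "(real \<times> real) filter" and b1 b2 :: real
  assumes F: "F \<le> min_at_top"
    and b: "b1 \<in> {0<..<1}" "b2 \<in> {0<..<1}"
    and dominated: "\<exists>C. \<forall>\<^sub>F (x, y) in min_at_top. joint_tail M X Y (b1 * x) (b2 * y) \<le> C * joint_tail M X Y x y"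
    and large_scale: "\<And>c. c > 0 \<Longrightarrow> ((\<lambda>(x, y). \<P>(\<omega> in M. \<Theta> \<omega> > c * min x y) / scaled_tail x y) \<longlongrightarrow> 0) F"
begin

lemma dominated_threshold:
  obtains C N where "0 \<le> C" "0 < N"
    "\<And>x y. x \<ge> N \<Longrightarrow> y \<ge> N \<Longrightarrow> joint_tail M X Y (b1 * x) (b2 * y) \<le> C * joint_tail M X Y x y"
proof -
  obtain C N where "0 < N" and
    le: "\<And>x y. x \<ge> N \<Longrightarrow> y \<ge> N \<Longrightarrow> joint_tail M X Y (b1 * x) (b2 * y) \<le> C * joint_tail M X Y x y"
    using dominated unfolding eventually_min_at_top by blast
  moreover have "C * joint_tail M X Y x y \<le> \<bar>C\<bar> * joint_tail M X Y x y" for x y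
    by (intro mult_right_mono) (auto simp: joint_tail_def)
  ultimately show ?thesis using that[of "\<bar>C\<bar>" N] by (meson abs_ge_zero order.trans)
qed

lemma eventually_large_scale_le:
  assumes "0 < N" "0 < \<epsilon>"
  shows "\<forall>\<^sub>F (x, y) in F. \<P>(\<omega> in M. \<Theta> \<omega> > min x y / N) \<le> \<epsilon> * scaled_tail x y"
proof -
  have "\<forall>\<^sub>F (x, y) in F. \<P>(\<omega> in M. \<Theta> \<omega> > 1 / N * min x y) / scaled_tail x y < \<epsilon>"
    using order_tendstoD(2)[OF large_scale[of "1 / N"], of \<epsilon>] assms by (simp add: case_prod_beta')
  moreover have "\<forall>\<^sub>F (x, y) in F. 0 < scaled_tail x y"
    by (rule filter_leD[OF F]) (use scaled_tail_pos in \<open>auto simp: eventually_min_at_top intro!: exI[of _ 1]\<close>)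
  ultimately show ?thesis
    by eventually_elim (auto simp: field_simps)
qed

lemma scaled_tail_dominated:
  "\<exists>C. \<forall>\<^sub>F (x, y) in F. scaled_tail (b1 * x) (b2 * y) \<le> C * scaled_tail x y"
proof -
  obtain C N where C: "0 \<le> C" and N: "0 < N" and
    le: "\<And>x y. x \<ge> N \<Longrightarrow> y \<ge> N \<Longrightarrow> joint_tail M X Y (b1 * x) (b2 * y) \<le> C * joint_tail M X Y x y"
    using dominated_threshold by blast
  have "\<forall>\<^sub>F (x, y) in F. x \<ge> 0 \<and> y \<ge> 0"
    by (rule filter_leD[OF F]) (auto simp: eventually_min_at_top intro!: exI[of _ 1])
  then have "\<forall>\<^sub>F (x, y) in F. scaled_tail (b1 * x) (b2 * y) \<le> (C + 1) * scaled_tail x y"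
    using eventually_large_scale_le[OF N zero_less_one]
  proof (eventually_elim, clarify)
    fix x y :: real
    assume xy: "0 \<le> x" "0 \<le> y" and large: "\<P>(\<omega> in M. \<Theta> \<omega> > min x y / N) \<le> 1 * scaled_tail x y"
    have "scaled_tail (b1 * x) (b2 * y)
        \<le> \<P>(\<omega> in M. \<Theta> \<omega> \<in> {0<..min x y / N} \<and> \<Theta> \<omega> * X \<omega> > b1 * x \<and> \<Theta> \<omega> * Y \<omega> > b2 * y)
          + \<P>(\<omega> in M. \<Theta> \<omega> > min x y / N)"
      using scaled_tail_split[of "b1 * x" "b2 * y" 0 "min x y / N"] xy b by simp
    also have "\<P>(\<omega> in M. \<Theta> \<omega> \<in> {0<..min x y / N} \<and> \<Theta> \<omega> * X \<omega> > b1 * x \<and> \<Theta> \<omega> * Y \<omega> > b2 * y)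
        \<le> C * \<P>(\<omega> in M. \<Theta> \<omega> \<in> {0<..min x y / N} \<and> \<Theta> \<omega> * X \<omega> > x \<and> \<Theta> \<omega> * Y \<omega> > y)"
      by (rule dominated_part_le) (use N C le in auto)
    also have "\<dots> \<le> C * scaled_tail x y"
      unfolding joint_tail_def using C by (intro mult_left_mono finite_measure_mono) auto
    finally show "scaled_tail (b1 * x) (b2 * y) \<le> (C + 1) * scaled_tail x y"
      using large by (simp add: algebra_simps)
  qed
  then show ?thesis by blast
qed

text \<open>The three ranges of the scale each contribute an excess of at most \<open>\<epsilon> H*\<close>: small scales by dominated
  variation and the choice of \<open>\<delta>\<close>, intermediate ones by long-tailedness of the pair, large ones by
  assumption. In the other direction the ratio is at least one by monotonicity.\<close>

lemma scaled_tail_long_tailed: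
  assumes long: "\<And>a1 a2 \<epsilon>. 0 \<le> a1 \<Longrightarrow> 0 \<le> a2 \<Longrightarrow> 0 < \<epsilon> \<Longrightarrow>
      \<forall>\<^sub>F (x, y) in min_at_top. joint_tail M X Y (x - a1) (y - a2) \<le> (1 + \<epsilon>) * joint_tail M X Y x y"
    and a: "0 \<le> a1" "0 \<le> a2"
  shows "((\<lambda>(x, y). scaled_tail (x - a1) (y - a2) / scaled_tail x y) \<longlongrightarrow> 1) F"
proof (rule tendstoI)
  fix e :: real assume "0 < e"
  define \<epsilon> where "\<epsilon> = e / 4"
  have \<epsilon>: "0 < \<epsilon>" using \<open>0 < e\<close> by (simp add: \<epsilon>_def)
  obtain C N1 where C: "0 \<le> C" and N1: "0 < N1" and
    dom: "\<And>x y. x \<ge> N1 \<Longrightarrow> y \<ge> N1 \<Longrightarrow> joint_tail M X Y (b1 * x) (b2 * y) \<le> C * joint_tail M X Y x y"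
    using dominated_threshold by blast
  let ?small = "\<lambda>\<delta>. \<P>(\<omega> in M. \<Theta> \<omega> \<in> {0<..\<delta>})"
  have "((\<lambda>\<delta>. C * (?small \<delta> / \<P>(\<omega> in M. \<Theta> \<omega> > \<delta>))) \<longlongrightarrow> C * 0) (at_right 0)"
    by (intro tendsto_intros small_scale_negligible)
  then have "\<forall>\<^sub>F \<delta> in at_right 0. C * (?small \<delta> / \<P>(\<omega> in M. \<Theta> \<omega> > \<delta>)) < \<epsilon>"
    using \<epsilon> by (intro order_tendstoD(2)) simp_all
  with eventually_prob_scale_gt_pos eventually_at_right_less[of "0::real"]
  have "\<forall>\<^sub>F \<delta> in at_right 0. 0 < \<delta> \<and> \<P>(\<omega> in M. \<Theta> \<omega> > \<delta>) > 0 \<and> C * (?small \<delta> / \<P>(\<omega> in M. \<Theta> \<omega> > \<delta>)) < \<epsilon>"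
    by eventually_elim simp
  then obtain \<delta> where \<delta>: "0 < \<delta>" and pos: "\<P>(\<omega> in M. \<Theta> \<omega> > \<delta>) > 0"
    and small: "C * (?small \<delta> / \<P>(\<omega> in M. \<Theta> \<omega> > \<delta>)) < \<epsilon>"
    using eventually_happens trivial_limit_at_right_real by blast
  obtain N2 where "0 < N2" and shift: "\<And>x y. x \<ge> N2 \<Longrightarrow> y \<ge> N2 \<Longrightarrow>
      joint_tail M X Y (x - a1 / \<delta>) (y - a2 / \<delta>) \<le> (1 + \<epsilon>) * joint_tail M X Y x y"
    using long[of "a1 / \<delta>" "a2 / \<delta>" \<epsilon>] a \<delta> \<epsilon> unfolding eventually_min_at_top by auto
  define N where "N = max N1 N2"
  have N: "0 < N" using N1 by (simp add: N_def)
  have "\<forall>\<^sub>F (x, y) in F. x \<ge> 0 \<and> y \<ge> 0 \<and> \<delta> \<le> min x y / N \<and> b1 * x \<le> x - a1 \<and> b2 * y \<le> y - a2"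
  proof (rule filter_leD[OF F])
    \<comment> \<open>\<open>a / (1 - b)\<close> is the point beyond which the shift by \<open>a\<close> moves less than the dilation by \<open>b\<close>.\<close>
    let ?K = "max 1 (max (\<delta> * N) (max (a1 / (1 - b1)) (a2 / (1 - b2))))"
    show "\<forall>\<^sub>F (x, y) in min_at_top.
        x \<ge> 0 \<and> y \<ge> 0 \<and> \<delta> \<le> min x y / N \<and> b1 * x \<le> x - a1 \<and> b2 * y \<le> y - a2"
      unfolding eventually_min_at_top
    proof (intro exI[of _ ?K] conjI allI impI)
      fix x y assume xy: "?K \<le> x" "?K \<le> y"
      then have "a1 / (1 - b1) \<le> x" "a2 / (1 - b2) \<le> y" by auto
      with b show "b1 * x \<le> x - a1" "b2 * y \<le> y - a2" by (auto simp: field_simps)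
      show "\<delta> \<le> min x y / N" using xy N by (simp add: pos_le_divide_eq)
    qed auto
  qed
  then show "\<forall>\<^sub>F p in F. dist (case p of (x, y) \<Rightarrow> scaled_tail (x - a1) (y - a2) / scaled_tail x y) 1 < e"
    using eventually_large_scale_le[OF N \<epsilon>]
  proof (eventually_elim, clarify)
    fix x y :: real
    assume xy: "0 \<le> x" "0 \<le> y" and t: "\<delta> \<le> min x y / N"
      and x: "b1 * x \<le> x - a1" and y: "b2 * y \<le> y - a2"
      and large: "\<P>(\<omega> in M. \<Theta> \<omega> > min x y / N) \<le> \<epsilon> * scaled_tail x y"
    have bxy: "0 \<le> b1 * x" "0 \<le> b2 * y" using b xy by auto
    have "\<P>(\<omega> in M. \<Theta> \<omega> \<in> {0<..\<delta>} \<and> \<Theta> \<omega> * X \<omega> > x - a1 \<and> \<Theta> \<omega> * Y \<omega> > y - a2)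
        \<le> \<P>(\<omega> in M. \<Theta> \<omega> \<in> {0<..\<delta>} \<and> \<Theta> \<omega> * X \<omega> > b1 * x \<and> \<Theta> \<omega> * Y \<omega> > b2 * y)"
      using x y by (intro finite_measure_mono) auto
    also have "\<dots> \<le> C * \<P>(\<omega> in M. \<Theta> \<omega> \<in> {0<..\<delta>} \<and> \<Theta> \<omega> * X \<omega> > x \<and> \<Theta> \<omega> * Y \<omega> > y)"
      by (rule dominated_part_le[where N = N]) (use t N C dom in \<open>auto simp: N_def\<close>)
    also have "\<P>(\<omega> in M. \<Theta> \<omega> \<in> {0<..\<delta>} \<and> \<Theta> \<omega> * X \<omega> > x \<and> \<Theta> \<omega> * Y \<omega> > y)
        \<le> ?small \<delta> / \<P>(\<omega> in M. \<Theta> \<omega> > \<delta>) * scaled_tail x y"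
      using small_scale_part_le[OF \<delta> xy] pos by (simp add: field_simps)
    also have "C * (?small \<delta> / \<P>(\<omega> in M. \<Theta> \<omega> > \<delta>) * scaled_tail x y) \<le> \<epsilon> * scaled_tail x y"
      unfolding mult.assoc[symmetric] using small scaled_tail_pos[OF xy]
      by (intro mult_right_mono) auto
    finally have small_part: "\<P>(\<omega> in M. \<Theta> \<omega> \<in> {0<..\<delta>} \<and> \<Theta> \<omega> * X \<omega> > x - a1 \<and> \<Theta> \<omega> * Y \<omega> > y - a2)
        \<le> \<epsilon> * scaled_tail x y" using C by (simp add: mult_left_mono)
    have "\<P>(\<omega> in M. \<Theta> \<omega> \<in> {\<delta><..min x y / N} \<and> \<Theta> \<omega> * X \<omega> > x - a1 \<and> \<Theta> \<omega> * Y \<omega> > y - a2)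
        \<le> (1 + \<epsilon>) * \<P>(\<omega> in M. \<Theta> \<omega> \<in> {\<delta><..min x y / N} \<and> \<Theta> \<omega> * X \<omega> > x \<and> \<Theta> \<omega> * Y \<omega> > y)"
      by (rule shifted_part_le) (use N \<epsilon> \<delta> a shift in \<open>auto simp: N_def\<close>)
    also have "\<dots> \<le> (1 + \<epsilon>) * scaled_tail x y"
      unfolding joint_tail_def using \<epsilon> by (intro mult_left_mono finite_measure_mono) auto
    finally have "scaled_tail (x - a1) (y - a2) \<le> (1 + 3 * \<epsilon>) * scaled_tail x y"
      using small_part large scaled_tail_split[of "x - a1" "y - a2" \<delta> "min x y / N"] bxy x y
      by (simp add: algebra_simps)
    moreover have "scaled_tail x y \<le> scaled_tail (x - a1) (y - a2)"
      using a by (intro scaled_tail_mono) auto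
    ultimately have "1 \<le> scaled_tail (x - a1) (y - a2) / scaled_tail x y"
      "scaled_tail (x - a1) (y - a2) / scaled_tail x y \<le> 1 + 3 * \<epsilon>"
      using scaled_tail_pos[OF xy] by (auto simp: field_simps)
    then show "dist (scaled_tail (x - a1) (y - a2) / scaled_tail x y) 1 < e"
      using \<epsilon> by (simp add: dist_real_def \<epsilon>_def)
  qed
qed

end

end

section \<open>From one-dimensional to joint tails\<close>

lemma Limsup_ratio_finite_iff:
  fixes f g :: "'b \<Rightarrow> real"
  assumes "\<forall>\<^sub>F p in F. 0 < g p"
  shows "Limsup F (\<lambda>p. ereal (f p / g p)) < \<infinity> \<longleftrightarrow> (\<exists>C. \<forall>\<^sub>F p in F. f p \<le> C * g p)"
proof
  assume "Limsup F (\<lambda>p. ereal (f p / g p)) < \<infinity>"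
  then obtain n :: nat where "Limsup F (\<lambda>p. ereal (f p / g p)) < ereal (real n)"
    using less_PInf_Ex_of_nat[THEN iffD1, OF less_imp_neq] by auto
  then have "\<forall>\<^sub>F p in F. ereal (f p / g p) < ereal (real n)" by (rule Limsup_lessD)
  with assms have "\<forall>\<^sub>F p in F. f p \<le> real n * g p"
    by eventually_elim (auto simp: field_simps)
  then show "\<exists>C. \<forall>\<^sub>F p in F. f p \<le> C * g p" by blast
next
  assume "\<exists>C. \<forall>\<^sub>F p in F. f p \<le> C * g p"
  then obtain C where "\<forall>\<^sub>F p in F. f p \<le> C * g p" by blast
  with assms have "\<forall>\<^sub>F p in F. ereal (f p / g p) \<le> ereal C"
    by eventually_elim (auto simp: field_simps)
  then have "Limsup F (\<lambda>p. ereal (f p / g p)) \<le> ereal C" by (rule Limsup_bounded)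
  then show "Limsup F (\<lambda>p. ereal (f p / g p)) < \<infinity>" by (rule le_less_trans) simp
qed

lemma eventually_le_of_ratio_tendsto_1:
  fixes f g :: "'b \<Rightarrow> real"
  assumes "\<forall>\<^sub>F p in F. 0 < g p" "((\<lambda>p. f p / g p) \<longlongrightarrow> 1) F" "0 < \<epsilon>"
  shows "\<forall>\<^sub>F p in F. f p \<le> (1 + \<epsilon>) * g p"
proof -
  have "\<forall>\<^sub>F p in F. f p / g p < 1 + \<epsilon>" using assms by (intro order_tendstoD(2)) auto
  with assms(1) show ?thesis by eventually_elim (auto simp: field_simps)
qed

lemma filterlim_diagonal_min_at_top: "filterlim (\<lambda>x. (x, x)) min_at_top at_top"
  by (simp add: min_at_top_def filterlim_filtercomap_iff o_def filterlim_ident)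

lemma filterlim_max_min_at_top: "filterlim (\<lambda>(x, y). max x y) at_top min_at_top"
proof (rule filterlim_at_top_mono)
  show "filterlim (\<lambda>(x, y). min x y) at_top min_at_top"
    unfolding min_at_top_def by (rule filterlim_filtercomap)
  show "\<forall>\<^sub>F p in min_at_top. (case p of (x, y) \<Rightarrow> min x y) \<le> (case p of (x, y) \<Rightarrow> max x y)"
    by (rule always_eventually) (simp add: case_prod_beta' min.coboundedI1)
qed

lemma (in prob_space) joint_tail_diagonal:
  assumes [measurable]: "X \<in> borel_measurable M"
  shows "joint_tail M X X x y = tail (distr M borel X) (max x y)"
proof -
  have "joint_tail M X X x y = \<P>(\<omega> in M. \<not> X \<omega> \<le> max x y)"
    by (auto simp: joint_tail_def intro!: arg_cong[where f = prob])
  also have "\<dots> = 1 - \<P>(\<omega> in M. X \<omega> \<le> max x y)" by (rule prob_neg) measurable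
  finally show ?thesis
    by (simp add: tail_def cdf_def measure_distr vimage_def Int_def conj_commute)
qed

lemma (in real_distribution) tail_antimono: "x \<le> y \<Longrightarrow> tail M y \<le> tail M x"
  by (simp add: tail_def cdf_nondecreasing)

lemma eventually_tail_pos:
  assumes "\<forall>x\<ge>0. tail F x > 0"
  shows "\<forall>\<^sub>F x in at_top. 0 < tail F x"
  using eventually_ge_at_top[of 0] by (rule eventually_mono) (use assms in blast)

text \<open>Shifting the two coordinates separately moves their maximum by no more than the larger shift.\<close>

lemma (in real_distribution) long_tailed_max:
  assumes long: "long_tailed M" and a: "0 \<le> a1" "0 \<le> a2" and \<epsilon>: "0 < \<epsilon>"
  shows "\<forall>\<^sub>F (x, y) in min_at_top. tail M (max (x - a1) (y - a2)) \<le> (1 + \<epsilon>) * tail M (max x y)"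
proof -
  \<comment> \<open>The summand one keeps the shift positive when both given shifts are zero.\<close>
  define a where "a = max a1 a2 + 1"
  have "0 < a" using a by (simp add: a_def)
  have "\<forall>\<^sub>F z in at_top. tail M (z - a) \<le> (1 + \<epsilon>) * tail M z"
  proof (rule eventually_le_of_ratio_tendsto_1[OF eventually_tail_pos])
    show "\<forall>x\<ge>0. 0 < tail M x" using long unfolding long_tailed_def by blast
    show "((\<lambda>z. tail M (z - a) / tail M z) \<longlongrightarrow> 1) at_top"
      using long \<open>0 < a\<close> unfolding long_tailed_def by blast
  qed (rule \<epsilon>)
  then have "\<forall>\<^sub>F p in min_at_top. tail M ((case p of (x, y) \<Rightarrow> max x y) - a)
      \<le> (1 + \<epsilon>) * tail M (case p of (x, y) \<Rightarrow> max x y)"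
    by (rule eventually_compose_filterlim[OF _ filterlim_max_min_at_top])
  then show ?thesis
  proof (eventually_elim, clarify)
    fix x y assume le: "tail M (max x y - a) \<le> (1 + \<epsilon>) * tail M (max x y)"
    have "tail M (max (x - a1) (y - a2)) \<le> tail M (max x y - a)"
      by (rule tail_antimono) (auto simp: a_def)
    with le show "tail M (max (x - a1) (y - a2)) \<le> (1 + \<epsilon>) * tail M (max x y)" by simp
  qed
qed

text \<open>The one-dimensional case, obtained from the pair \<open>(X, X)\<close> along the diagonal.\<close>

lemma (in prob_space) scaled_marginal:
  assumes X [measurable]: "X \<in> borel_measurable M" and [measurable]: "\<Theta> \<in> borel_measurable M"
    and nonneg: "AE \<omega> in M. \<Theta> \<omega> \<ge> 0" and nonzero: "cdf (distr M borel \<Theta>) 0 < 1"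
    and indep: "independent_rvs M borel \<Theta> borel X"
    and dom: "dominatedly_varying (distr M borel X)" and long: "long_tailed (distr M borel X)"
    and large: "\<And>c. c > 0 \<Longrightarrow>
      ((\<lambda>x. \<P>(\<omega> in M. \<Theta> \<omega> > c * x) / tail (distr M borel (\<lambda>\<omega>. \<Theta> \<omega> * X \<omega>)) x) \<longlongrightarrow> 0) at_top"
  shows "dominatedly_varying (distr M borel (\<lambda>\<omega>. \<Theta> \<omega> * X \<omega>))"
    and "long_tailed (distr M borel (\<lambda>\<omega>. \<Theta> \<omega> * X \<omega>))"
proof -
  let ?F = "distr M borel X" and ?H = "distr M borel (\<lambda>\<omega>. \<Theta> \<omega> * X \<omega>)"
  let ?diag = "filtermap (\<lambda>x::real. (x, x)) at_top"
  have pos: "\<forall>x\<ge>0. tail ?F x > 0" using long by (simp add: long_tailed_def)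
  note diag = joint_tail_diagonal[OF X]
  have diag_scaled: "joint_tail M (\<lambda>\<omega>. \<Theta> \<omega> * X \<omega>) (\<lambda>\<omega>. \<Theta> \<omega> * X \<omega>) x y = tail ?H (max x y)" for x y
    by (rule joint_tail_diagonal) measurable
  interpret XX: nondegenerate_scaled_pair M X X \<Theta>
  proof
    show "independent_rvs M borel \<Theta> borel (\<lambda>\<omega>. (X \<omega>, X \<omega>))"
      using independent_rvs_compose[OF indep, of "\<lambda>x. (x, x)" borel] by simp
  qed (use nonneg nonzero pos in \<open>auto simp: diag\<close>)
  interpret F: real_distribution ?F by (rule real_distribution_distr) simp
  have H_pos: "\<forall>x\<ge>0. tail ?H x > 0"
    using XX.scaled_tail_pos[of x x for x] by (simp add: diag_scaled)
  have le: "?diag \<le> min_at_top"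
    using filterlim_diagonal_min_at_top by (simp add: filterlim_def)
  obtain b where b: "b \<in> {0<..<1}" and b_fin: "Limsup at_top (\<lambda>x. ereal (tail ?F (b * x) / tail ?F x)) < \<infinity>"
    using dom by (auto simp: dominatedly_varying_def)
  obtain C where "\<forall>\<^sub>F z in at_top. tail ?F (b * z) \<le> C * tail ?F z"
    using b_fin unfolding Limsup_ratio_finite_iff[OF eventually_tail_pos[OF pos]] by blast
  then have "\<forall>\<^sub>F p in min_at_top. tail ?F (b * (case p of (x, y) \<Rightarrow> max x y))
      \<le> C * tail ?F (case p of (x, y) \<Rightarrow> max x y)"
    by (rule eventually_compose_filterlim[OF _ filterlim_max_min_at_top])
  then have "\<forall>\<^sub>F (x, y) in min_at_top. joint_tail M X X (b * x) (b * y) \<le> C * joint_tail M X X x y"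
  proof (eventually_elim, clarify)
    fix x y assume "tail ?F (b * max x y) \<le> C * tail ?F (max x y)"
    then show "joint_tail M X X (b * x) (b * y) \<le> C * joint_tail M X X x y"
      using b by (simp add: diag max_mult_distrib_left)
  qed
  then have D: "\<exists>C. \<forall>\<^sub>F (x, y) in min_at_top. joint_tail M X X (b * x) (b * y) \<le> C * joint_tail M X X x y"
    by blast
  have large_diag: "((\<lambda>(x, y). \<P>(\<omega> in M. \<Theta> \<omega> > c * min x y) / XX.scaled_tail x y) \<longlongrightarrow> 0) ?diag"
    if "c > 0" for c
    using large[OF that] by (simp add: filterlim_filtermap diag_scaled)
  have "\<exists>C. \<forall>\<^sub>F x in at_top. tail ?H (b * x) \<le> C * tail ?H x"
    using XX.scaled_tail_dominated[OF le b b D large_diag] by (simp add: eventually_filtermap diag_scaled)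
  then show "dominatedly_varying ?H"
    unfolding dominatedly_varying_def Limsup_ratio_finite_iff[OF eventually_tail_pos[OF H_pos]]
    using H_pos b by blast
  have "((\<lambda>x. tail ?H (x - a) / tail ?H x) \<longlongrightarrow> 1) at_top" if "a > 0" for a
    using XX.scaled_tail_long_tailed[OF le b b D large_diag, of a a] F.long_tailed_max[OF long] that
    by (simp add: filterlim_filtermap diag_scaled diag)
  then show "long_tailed ?H"
    using H_pos by (simp add: long_tailed_def)
qed

section \<open>Closure under random scaling\<close>

theorem corollary5p1:
  fixes M :: "'a measure" and X Y \<Theta> :: "'a \<Rightarrow> real"
  assumes "prob_space M"
    and "X \<in> borel_measurable M" and "Y \<in> borel_measurable M" and "\<Theta> \<in> borel_measurable M"
    and "AE \<omega> in M. \<Theta> \<omega> \<ge> 0"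
    and "cdf (distr M borel \<Theta>) 0 < 1"
    and "independent_rvs M borel \<Theta> borel (\<lambda>\<omega>. (X \<omega>, Y \<omega>))"
    and "dominatedly_varying_long_tailed2 M X Y"
    and "\<And>c::real. c > 0 \<Longrightarrow>
      ((\<lambda>(x, y). \<P>(\<omega> in M. \<Theta> \<omega> > c * min x y)
          / joint_tail M (\<lambda>\<omega>. \<Theta> \<omega> * X \<omega>) (\<lambda>\<omega>. \<Theta> \<omega> * Y \<omega>) x y) \<longlongrightarrow> 0) min_at_top"
  shows "dominatedly_varying_long_tailed2 M (\<lambda>\<omega>. \<Theta> \<omega> * X \<omega>) (\<lambda>\<omega>. \<Theta> \<omega> * Y \<omega>)"
proof -
  interpret prob_space M by fact
  note [measurable] = assms(2-4)
  have D2: "dominatedly_varying2 M X Y" and L2: "long_tailed2 M X Y"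
    using assms(8) by (auto simp: dominatedly_varying_long_tailed2_def)
  interpret XY: nondegenerate_scaled_pair M X Y \<Theta>
    using assms(2-7) L2 by unfold_locales (auto simp: long_tailed2_def)
  have joint_pos: "\<forall>\<^sub>F p in min_at_top. 0 < (case p of (x, y) \<Rightarrow> joint_tail M X Y x y)"
    using XY.joint_tail_pos eventually_min_at_top[of "\<lambda>x y. 0 < joint_tail M X Y x y"]
    by (auto simp: case_prod_beta' intro!: exI[of _ 1])
  have scaled_pos: "\<forall>\<^sub>F p in min_at_top. 0 < (case p of (x, y) \<Rightarrow> XY.scaled_tail x y)"
    using XY.scaled_tail_pos eventually_min_at_top[of "\<lambda>x y. 0 < XY.scaled_tail x y"]
    by (auto simp: case_prod_beta' intro!: exI[of _ 1])

  obtain b1 b2 where b: "b1 \<in> {0<..<1}" "b2 \<in> {0<..<1}"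
    and "Limsup min_at_top (\<lambda>(x, y). ereal (joint_tail M X Y (b1 * x) (b2 * y) / joint_tail M X Y x y)) < \<infinity>"
    using D2 by (auto simp: dominatedly_varying2_def)
  then have dom: "\<exists>C. \<forall>\<^sub>F (x, y) in min_at_top. joint_tail M X Y (b1 * x) (b2 * y) \<le> C * joint_tail M X Y x y"
    using Limsup_ratio_finite_iff[OF joint_pos, of "\<lambda>(x, y). joint_tail M X Y (b1 * x) (b2 * y)"]
    by (simp add: case_prod_beta')
  have long: "\<forall>\<^sub>F (x, y) in min_at_top. joint_tail M X Y (x - a1) (y - a2) \<le> (1 + \<epsilon>) * joint_tail M X Y x y"
    if a: "0 \<le> a1" "0 \<le> a2" and \<epsilon>: "0 < \<epsilon>" for a1 a2 \<epsilon>
  proof (cases "a1 = 0 \<and> a2 = 0")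
    case True
    with \<epsilon> show ?thesis by (auto simp: joint_tail_def algebra_simps intro!: always_eventually)
  next
    case False
    with a have "((\<lambda>(x, y). joint_tail M X Y (x - a1) (y - a2) / joint_tail M X Y x y) \<longlongrightarrow> 1) min_at_top"
      using L2 by (auto simp: long_tailed2_def)
    then show ?thesis
      using eventually_le_of_ratio_tendsto_1[OF joint_pos, of "\<lambda>(x, y). joint_tail M X Y (x - a1) (y - a2)"] \<epsilon>
      by (simp add: case_prod_beta')
  qed

  have tail_scaled: "tail (distr M borel (\<lambda>\<omega>. \<Theta> \<omega> * Z \<omega>)) x = \<P>(\<omega> in M. \<Theta> \<omega> * Z \<omega> > x)"
    if [measurable]: "Z \<in> borel_measurable M" for Z x
    using joint_tail_diagonal[of "\<lambda>\<omega>. \<Theta> \<omega> * Z \<omega>" x x] by (simp add: joint_tail_def)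
  \<comment> \<open>On the diagonal the joint tail is a lower bound for each marginal tail, so the negligibility of
    large scales passes to the marginals.\<close>
  have large_marginal: "((\<lambda>x. \<P>(\<omega> in M. \<Theta> \<omega> > c * x) / tail (distr M borel (\<lambda>\<omega>. \<Theta> \<omega> * Z \<omega>)) x) \<longlongrightarrow> 0) at_top"
    if c: "c > 0" and Z: "Z \<in> borel_measurable M"
      and le: "\<And>x. XY.scaled_tail x x \<le> \<P>(\<omega> in M. \<Theta> \<omega> * Z \<omega> > x)" for c Z
  proof (rule tendsto_sandwich[OF _ _ tendsto_const])
    show "((\<lambda>x. \<P>(\<omega> in M. \<Theta> \<omega> > c * x) / XY.scaled_tail x x) \<longlongrightarrow> 0) at_top"
      using filterlim_compose[OF assms(9)[OF c] filterlim_diagonal_min_at_top] by simp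
    show "\<forall>\<^sub>F x in at_top. 0 \<le> \<P>(\<omega> in M. \<Theta> \<omega> > c * x) / tail (distr M borel (\<lambda>\<omega>. \<Theta> \<omega> * Z \<omega>)) x"
      by (simp add: tail_scaled[OF Z])
    show "\<forall>\<^sub>F x in at_top. \<P>(\<omega> in M. \<Theta> \<omega> > c * x) / tail (distr M borel (\<lambda>\<omega>. \<Theta> \<omega> * Z \<omega>)) x
        \<le> \<P>(\<omega> in M. \<Theta> \<omega> > c * x) / XY.scaled_tail x x"
      using eventually_ge_at_top[of 0]
    proof eventually_elim
      case (elim x)
      show ?case unfolding tail_scaled[OF Z]
        by (intro divide_left_mono le mult_pos_pos XY.scaled_tail_pos elim
            less_le_trans[OF XY.scaled_tail_pos le]) simp
    qed
  qed
  have indep_X: "independent_rvs M borel \<Theta> borel X" and indep_Y: "independent_rvs M borel \<Theta> borel Y"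
    using independent_rvs_compose[OF assms(7), of fst borel] independent_rvs_compose[OF assms(7), of snd borel]
    by (simp_all add: borel_prod[symmetric])
  have DX: "dominatedly_varying (distr M borel X)" and DY: "dominatedly_varying (distr M borel Y)"
    using D2 by (auto simp: dominatedly_varying2_def)
  have LX: "long_tailed (distr M borel X)" and LY: "long_tailed (distr M borel Y)"
    using L2 by (auto simp: long_tailed2_def)
  have le_X: "XY.scaled_tail x x \<le> \<P>(\<omega> in M. \<Theta> \<omega> * X \<omega> > x)"
    and le_Y: "XY.scaled_tail x x \<le> \<P>(\<omega> in M. \<Theta> \<omega> * Y \<omega> > x)" for x
    unfolding joint_tail_def by (auto intro!: finite_measure_mono)
  note marginal_X = scaled_marginal[OF assms(2,4,5,6) indep_X DX LX large_marginal[OF _ assms(2) le_X]]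
  note marginal_Y = scaled_marginal[OF assms(3,4,5,6) indep_Y DY LY large_marginal[OF _ assms(3) le_Y]]

  have "Limsup min_at_top
      (\<lambda>(x, y). ereal (XY.scaled_tail (b1 * x) (b2 * y) / XY.scaled_tail x y)) < \<infinity>"
    using XY.scaled_tail_dominated[OF order.refl b dom assms(9)]
      Limsup_ratio_finite_iff[OF scaled_pos, of "\<lambda>(x, y). XY.scaled_tail (b1 * x) (b2 * y)"]
    by (simp add: case_prod_beta')
  then have "dominatedly_varying2 M (\<lambda>\<omega>. \<Theta> \<omega> * X \<omega>) (\<lambda>\<omega>. \<Theta> \<omega> * Y \<omega>)"
    unfolding dominatedly_varying2_def using marginal_X(1) marginal_Y(1) b XY.scaled_tail_pos by blast
  moreover have "long_tailed2 M (\<lambda>\<omega>. \<Theta> \<omega> * X \<omega>) (\<lambda>\<omega>. \<Theta> \<omega> * Y \<omega>)"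
    unfolding long_tailed2_def
    using marginal_X(2) marginal_Y(2) XY.scaled_tail_pos
      XY.scaled_tail_long_tailed[OF order.refl b dom assms(9) long] by auto
  ultimately show ?thesis by (simp add: dominatedly_varying_long_tailed2_def)
qed

end
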